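(* Let $s>1$ be fixed and let $\gamma\in\mathbb{R}$ be such that $Q_\gamma$ satisfies the matching condition. Then $s$ is an algebraic integer, i.e. there is a monic polynomial $p\in\mathbb{Z}[x]$ such that $p(s)=0$. In particular, matching cannot hold for any non-integer rational value of $s$.
   Context: For fixed $s>1$ and $\gamma\in\mathbb{R}$, $Q_\gamma:\mathbb{R}\to\mathbb{R}$ is defined by $Q_\gamma(x)=x+1$ if $x\le\gamma$ and $Q_\gamma(x)=1+s(1-x)$ if $x>\gamma$. Write $Q_\gamma^k(\gamma^{\pm}):=\lim_{x\to\gamma^{\pm}}Q_\gamma^k(x)$ and let $(Q_\gamma^k)'(\gamma^\pm)$ be the one-sided derivatives. $Q_\gamma$ satisfies the matching condition if there exist positive integers $\kappa^\pm$ with $Q_\gamma^{\kappa^-}(\gamma^-)=Q_\gamma^{\kappa^+}(\gamma^+)$ and $(Q_\gamma^{\kappa^-})'(\gamma^-)=(Q_\gamma^{\kappa^+})'(\gamma^+)$. *)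

theory Defs
  imports "HOL-Analysis.Analysis" "HOL-Computational_Algebra.Polynomial"
begin

definition Q :: "real \<Rightarrow> real \<Rightarrow> real \<Rightarrow> real" where
  "Q s \<gamma> x = (if x \<le> \<gamma> then x + 1 else 1 + s * (1 - x))"

text \<open>
  \<open>one_sided_jet F f a y D\<close> says that \<open>f\<close> has limit \<open>y\<close> at \<open>a\<close> along \<open>F\<close> and one-sided
  derivative \<open>D\<close> there, where \<open>F\<close> is \<open>at_left a\<close> or \<open>at_right a\<close>. The iterates of \<open>Q s \<gamma>\<close> are in
  general discontinuous at \<open>\<gamma>\<close>, so the difference quotient has to be based at the one-sided limit
  \<open>y\<close> and not at the value \<open>f a\<close>; hence the update at \<open>a\<close>.
\<close>
definition one_sided_jet ::
  "real filter \<Rightarrow> (real \<Rightarrow> real) \<Rightarrow> real \<Rightarrow> real \<Rightarrow> real \<Rightarrow> bool" where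
  "one_sided_jet F f a y D \<longleftrightarrow> (f \<longlongrightarrow> y) F \<and> (f(a := y) has_real_derivative D) F"

definition matching :: "real \<Rightarrow> real \<Rightarrow> bool" where
  "matching s \<gamma> \<longleftrightarrow> (\<exists>\<kappa>\<^sub>m \<kappa>\<^sub>p :: nat. \<kappa>\<^sub>m > 0 \<and> \<kappa>\<^sub>p > 0 \<and>
     (\<exists>y D. one_sided_jet (at_left \<gamma>) (Q s \<gamma> ^^ \<kappa>\<^sub>m) \<gamma> y D \<and>
            one_sided_jet (at_right \<gamma>) (Q s \<gamma> ^^ \<kappa>\<^sub>p) \<gamma> y D))"

end

theory Submission
  imports Defs
begin

text \<open>
  Put \<open>t = - s\<close> and measure points by their displacement \<open>u = x - 1\<close> from the fixed point of the
  decreasing branch. Then the two branches of \<open>Q s \<gamma>\<close> are \<open>u \<mapsto> u + 1\<close> and \<open>u \<mapsto> t * u\<close>.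
  On a small one-sided neighbourhood of \<open>\<gamma>\<close> a given iterate uses a fixed sequence of branches, so
  there it is \<open>u \<mapsto> t ^ n * u + q(t)\<close>, where \<open>n\<close> counts the uses of the decreasing branch and \<open>q\<close>
  is an integer polynomial of degree at most \<open>n\<close>. The coefficient of \<open>t ^ n\<close> in \<open>q\<close> is the number
  of translations that precede the first use of the decreasing branch, since only these get
  multiplied by \<open>t\<close> all \<open>n\<close> times. To the right of \<open>\<gamma>\<close> that number is \<open>0\<close>; to
  the left it is \<open>1\<close> as soon as there are two steps, because \<open>\<gamma> + 1 > \<gamma>\<close>. A single step from the
  left is the bare translation, and its slope \<open>1\<close> never occurs on the right.

  Under matching the one-sided slopes agree, which forces the same \<open>n\<close> on both sides because
  \<open>\<bar>t\<bar> > 1\<close>, and then the one-sided limits agree only if the two polynomials take the same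
  value at \<open>t\<close>. Their difference has leading term \<open>t ^ n\<close>, so \<open>t\<close>, and with it \<open>s\<close>, is an algebraic
  integer. The rational algebraic integers are the integers. The ingredients are the shape of the
  iterates (\<open>affine_germ_iterate\<close>, \<open>affine_germ_left\<close>, \<open>affine_germ_right\<close>) and the reading of
  slope and limit off that shape (\<open>one_sided_jet_affine\<close>).
\<close>

lemma one_sided_jet_affine:
  fixes a b \<gamma> :: real
  assumes F: "F = at_left \<gamma> \<or> F = at_right \<gamma>"
    and f: "eventually (\<lambda>x. f x = a * x + b) F"
    and jet: "one_sided_jet F f \<gamma> y D"
  shows "y = a * \<gamma> + b" and "D = a"
proof -
  obtain S where S: "F = at \<gamma> within S" and nontriv: "F \<noteq> bot"
    using F by auto
  have "((\<lambda>x. a * x + b) \<longlongrightarrow> a * \<gamma> + b) F"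
    unfolding S by (intro tendsto_intros)
  then have "(f \<longlongrightarrow> a * \<gamma> + b) F"
    using f by (subst tendsto_cong) auto
  then show y: "y = a * \<gamma> + b"
    using jet nontriv tendsto_unique unfolding one_sided_jet_def by blast
  have "eventually (\<lambda>x. x \<noteq> \<gamma>) F"
    unfolding S by (simp add: eventually_at_filter)
  with f have "eventually (\<lambda>x. ((f(\<gamma> := y)) x - (f(\<gamma> := y)) \<gamma>) / (x - \<gamma>) = a) F"
    by eventually_elim (simp add: y field_simps)
  then have "((\<lambda>x. ((f(\<gamma> := y)) x - (f(\<gamma> := y)) \<gamma>) / (x - \<gamma>)) \<longlongrightarrow> a) F"
    by (rule tendsto_eventually)
  moreover have "((\<lambda>x. ((f(\<gamma> := y)) x - (f(\<gamma> := y)) \<gamma>) / (x - \<gamma>)) \<longlongrightarrow> D) F"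
    using jet unfolding one_sided_jet_def S has_field_derivative_iff by blast
  ultimately show "D = a"
    using nontriv tendsto_unique by blast
qed

text \<open>
  If the limit of the affine map at \<open>\<gamma>\<close> is not \<open>\<gamma>\<close>, continuity decides the side; if it is \<open>\<gamma>\<close>, the
  sign of the slope does.
\<close>
lemma affine_one_side:
  fixes a b \<gamma> :: real
  assumes F: "F = at_left \<gamma> \<or> F = at_right \<gamma>" and "a \<noteq> 0"
  shows "eventually (\<lambda>x. a * x + b \<le> \<gamma>) F \<or> eventually (\<lambda>x. a * x + b > \<gamma>) F"
proof -
  have lim: "((\<lambda>x. a * x + b) \<longlongrightarrow> a * \<gamma> + b) F"
    using F by (auto intro!: tendsto_intros)
  consider "a * \<gamma> + b < \<gamma>" | "a * \<gamma> + b > \<gamma>" | "a * \<gamma> + b = \<gamma>"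
    by linarith
  then show ?thesis
  proof cases
    case 1
    then have "eventually (\<lambda>x. a * x + b < \<gamma>) F"
      using order_tendstoD(2)[OF lim] by blast
    then have "eventually (\<lambda>x. a * x + b \<le> \<gamma>) F"
      by eventually_elim simp
    then show ?thesis ..
  next
    case 2
    then show ?thesis
      using order_tendstoD(1)[OF lim] by blast
  next
    case 3
    then have shift: "a * x + b = \<gamma> + a * (x - \<gamma>)" for x
      by (simp add: algebra_simps)
    have "eventually (\<lambda>x. x < \<gamma>) F \<or> eventually (\<lambda>x. x > \<gamma>) F"
      using F by (auto simp: eventually_at_filter)
    then have "eventually (\<lambda>x. a * (x - \<gamma>) < 0) F \<or> eventually (\<lambda>x. a * (x - \<gamma>) > 0) F"
      using \<open>a \<noteq> 0\<close> unfolding mult_less_0_iff zero_less_mult_iff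
      by (cases "a > 0") (auto elim: eventually_mono)
    then show ?thesis
      unfolding shift by (auto elim: eventually_mono)
  qed
qed

text \<open>
  The parameter \<open>e\<close> is the coefficient of \<open>(- s) ^ n\<close>, the only trace of the starting side that
  survives further iteration. The condition \<open>n \<ge> 1\<close> says that the decreasing branch has already been
  used, so that later translations, which change the constant coefficient, leave \<open>e\<close> alone.
\<close>
definition affine_germ ::
  "real filter \<Rightarrow> real \<Rightarrow> (real \<Rightarrow> real) \<Rightarrow> real \<Rightarrow> nat \<Rightarrow> real poly \<Rightarrow> bool" where
  "affine_germ F s f e n q \<longleftrightarrow>
     n \<ge> 1 \<and> degree q \<le> n \<and> coeff q n = e \<and> (\<forall>i. coeff q i \<in> \<int>) \<and>
     eventually (\<lambda>x. f x = (- s) ^ n * x + (1 - (- s) ^ n + poly q (- s))) F"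

text \<open>
  In the coordinate \<open>u = x - 1\<close> the translation adds the constant \<open>1\<close> to \<open>q\<close>, and the decreasing
  branch multiplies everything by \<open>- s\<close>, which shifts the coefficients of \<open>q\<close> by one place.
\<close>
lemma affine_germ_step:
  assumes F: "F = at_left \<gamma> \<or> F = at_right \<gamma>" and "s > 1"
    and germ: "affine_germ F s f e n q"
  shows "\<exists>n' q'. affine_germ F s (Q s \<gamma> \<circ> f) e n' q'"
proof -
  let ?a = "(- s) ^ n" and ?b = "1 - (- s) ^ n + poly q (- s)"
  have n: "n \<ge> 1" and q: "degree q \<le> n" "coeff q n = e" "\<And>i. coeff q i \<in> \<int>"
    and f: "eventually (\<lambda>x. f x = ?a * x + ?b) F"
    using germ unfolding affine_germ_def by blast+
  have "?a \<noteq> 0"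
    using \<open>s > 1\<close> by simp
  with F consider (translation) "eventually (\<lambda>x. ?a * x + ?b \<le> \<gamma>) F"
    | (decreasing) "eventually (\<lambda>x. ?a * x + ?b > \<gamma>) F"
    using affine_one_side by blast
  then show ?thesis
  proof cases
    case translation
    with f have "eventually (\<lambda>x. (Q s \<gamma> \<circ> f) x = ?a * x + (1 - ?a + poly (q + 1) (- s))) F"
      by eventually_elim (simp add: Q_def)
    moreover have "degree (q + 1) \<le> n"
      using q(1) by (intro degree_add_le) auto
    moreover have "coeff (q + 1) n = e"
      using q(2) n by simp
    moreover have "coeff (q + 1) i \<in> \<int>" for i
      using q(3)[of i] by (simp add: coeff_1)
    ultimately have "affine_germ F s (Q s \<gamma> \<circ> f) e n (q + 1)"
      using n unfolding affine_germ_def by blast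
    then show ?thesis by blast
  next
    case decreasing
    with f have "eventually (\<lambda>x. (Q s \<gamma> \<circ> f) x =
        (- s) ^ Suc n * x + (1 - (- s) ^ Suc n + poly (pCons 0 q) (- s))) F"
    proof eventually_elim
      case (elim x)
      then have "(Q s \<gamma> \<circ> f) x = 1 + s * (1 - (?a * x + ?b))"
        by (simp add: Q_def)
      then show ?case
        by (simp add: algebra_simps)
    qed
    moreover have "degree (pCons 0 q) \<le> Suc n"
      using q(1) degree_pCons_le[of 0 q] by linarith
    moreover have "coeff (pCons 0 q) (Suc n) = e"
      using q(2) by simp
    moreover have "coeff (pCons 0 q) i \<in> \<int>" for i
      using q(3) by (cases i) auto
    ultimately have "affine_germ F s (Q s \<gamma> \<circ> f) e (Suc n) (pCons 0 q)"
      unfolding affine_germ_def by auto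
    then show ?thesis by blast
  qed
qed

lemma affine_germ_iterate:
  assumes "F = at_left \<gamma> \<or> F = at_right \<gamma>" and "s > 1" and "k \<le> m"
    and "affine_germ F s (Q s \<gamma> ^^ k) e n q"
  shows "\<exists>n' q'. affine_germ F s (Q s \<gamma> ^^ m) e n' q'"
  using \<open>k \<le> m\<close>
proof (induction m rule: dec_induct)
  case base
  then show ?case using assms(4) by blast
next
  case (step m)
  then show ?case using affine_germ_step[OF assms(1,2)] by (auto simp: comp_def)
qed

text \<open>
  Two iterations are needed on the left: the first is the translation, and it moves a left
  neighbourhood of \<open>\<gamma>\<close> to the right of \<open>\<gamma>\<close>. This produces the polynomial \<open>X\<close>.
\<close>
lemma affine_germ_left:
  "affine_germ (at_left \<gamma>) s (Q s \<gamma> ^^ 2) 1 1 [:0, 1:]"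
proof -
  have "eventually (\<lambda>x. x < \<gamma>) (at_left \<gamma>)" "eventually (\<lambda>x. x > \<gamma> - 1) (at_left \<gamma>)"
    by (auto intro!: eventually_at_leftI[of "\<gamma> - 1"])
  then have "eventually (\<lambda>x. (Q s \<gamma> ^^ 2) x = (- s) ^ 1 * x + (1 - (- s) ^ 1 + poly [:0, 1:] (- s)))
      (at_left \<gamma>)"
    by eventually_elim (simp add: Q_def numeral_2_eq_2 algebra_simps)
  then show ?thesis
    unfolding affine_germ_def by (auto simp: coeff_pCons split: nat.split)
qed

lemma affine_germ_right:
  "affine_germ (at_right \<gamma>) s (Q s \<gamma> ^^ 1) 0 1 0"
proof -
  have "eventually (\<lambda>x. x > \<gamma>) (at_right \<gamma>)"
    by (simp add: eventually_at_filter)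
  then have "eventually (\<lambda>x. (Q s \<gamma> ^^ 1) x = (- s) ^ 1 * x + (1 - (- s) ^ 1 + poly 0 (- s)))
      (at_right \<gamma>)"
    by eventually_elim (simp add: Q_def algebra_simps)
  then show ?thesis
    unfolding affine_germ_def by simp
qed

lemma matching_imp_algebraic_int:
  assumes "s > 1" and "matching s \<gamma>"
  shows "algebraic_int s"
proof -
  obtain k m y D where k: "k > 0" and m: "m > 0"
    and left: "one_sided_jet (at_left \<gamma>) (Q s \<gamma> ^^ k) \<gamma> y D"
    and right: "one_sided_jet (at_right \<gamma>) (Q s \<gamma> ^^ m) \<gamma> y D"
    using assms(2) unfolding matching_def by blast
  obtain n q where germR: "affine_germ (at_right \<gamma>) s (Q s \<gamma> ^^ m) 0 n q"
    using affine_germ_iterate[OF _ \<open>s > 1\<close> _ affine_germ_right] m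
    by (metis One_nat_def Suc_leI)
  have jetR: "y = (- s) ^ n * \<gamma> + (1 - (- s) ^ n + poly q (- s))" "D = (- s) ^ n"
    using one_sided_jet_affine[OF _ _ right] germR unfolding affine_germ_def by blast+
  have "\<bar>D\<bar> = s ^ n"
    using jetR(2) \<open>s > 1\<close> by (simp add: power_abs)
  \<comment> \<open>A single step from the left has slope \<open>1\<close>, while every slope from the right exceeds \<open>1\<close> in
    absolute value.\<close>
  have "k \<noteq> 1"
  proof
    assume "k = 1"
    have "eventually (\<lambda>x. x < \<gamma>) (at_left \<gamma>)"
      by (simp add: eventually_at_filter)
    then have "eventually (\<lambda>x. (Q s \<gamma> ^^ k) x = 1 * x + 1) (at_left \<gamma>)"
      by eventually_elim (simp add: Q_def \<open>k = 1\<close>)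
    then have "D = 1"
      using one_sided_jet_affine(2)[OF _ _ left] by blast
    moreover have "s ^ n > 1"
      using germR \<open>s > 1\<close> unfolding affine_germ_def by (intro one_less_power) auto
    ultimately show False
      using \<open>\<bar>D\<bar> = s ^ n\<close> by simp
  qed
  with k have "2 \<le> k" by simp
  then obtain n' p where germL: "affine_germ (at_left \<gamma>) s (Q s \<gamma> ^^ k) 1 n' p"
    using affine_germ_iterate[OF _ \<open>s > 1\<close> _ affine_germ_left] by blast
  have jetL: "y = (- s) ^ n' * \<gamma> + (1 - (- s) ^ n' + poly p (- s))" "D = (- s) ^ n'"
    using one_sided_jet_affine[OF _ _ left] germL unfolding affine_germ_def by blast+
  have "s ^ n' = s ^ n"
    using jetL(2) \<open>\<bar>D\<bar> = s ^ n\<close> \<open>s > 1\<close> by (simp add: power_abs)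
  then have n': "n' = n"
    using \<open>s > 1\<close> by simp
  have deg: "degree (p - q) \<le> n" and lead: "coeff (p - q) n = 1"
    and int: "\<And>i. coeff (p - q) i \<in> \<int>"
    using germL germR unfolding affine_germ_def n' by (auto intro: degree_diff_le)
  have "degree (p - q) = n"
    using deg lead by (intro antisym le_degree) auto
  then have "lead_coeff (p - q) = 1"
    using lead by simp
  moreover have "poly (p - q) (- s) = 0"
    using jetL(1) jetR(1) n' by simp
  ultimately have "algebraic_int (- s)"
    using int by (intro algebraic_int.intros) blast+
  then show ?thesis
    using algebraic_int_minus by fastforce
qed

theorem theorem3:
  fixes s :: real
  assumes "s > 1"
  shows "(\<forall>\<gamma>. matching s \<gamma> \<longrightarrow>
            algebraic_int s \<and>
            (\<exists>p :: int poly. lead_coeff p = 1 \<and> poly (map_poly real_of_int p) s = 0)) \<and>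
         (s \<in> \<rat> \<and> s \<notin> \<int> \<longrightarrow> (\<forall>\<gamma>. \<not> matching s \<gamma>))"
proof (intro conjI allI impI)
  fix \<gamma>
  assume "matching s \<gamma>"
  then show "algebraic_int s"
    by (rule matching_imp_algebraic_int[OF assms])
  then show "\<exists>p :: int poly. lead_coeff p = 1 \<and> poly (map_poly real_of_int p) s = 0"
    by (auto simp: algebraic_int_altdef_ipoly)
next
  fix \<gamma>
  assume "s \<in> \<rat> \<and> s \<notin> \<int>"
  then show "\<not> matching s \<gamma>"
    using matching_imp_algebraic_int[OF assms] rational_algebraic_int_is_int by blast
qed

end
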